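(* Let $\Omega$ be an infinite set. Let $f:\Omega\to\Omega$ be injective and let $f(\Omega)$ be a cofinite and proper subset of $\Omega$. If $g:\Omega\to\Omega$ is surjective, then $g\not\equiv f$.
   Context: A subset $A\subseteq\Omega$ is cofinite if $\Omega\setminus A$ is finite. For self-maps $f,g$ of $\Omega$, $f\equiv g$ (almost equal) means that $\{\omega\in\Omega: f(\omega)\neq g(\omega)\}$ is finite. $f(\Omega)$ is the range of $f$. *)

theory Defs
  imports "HOL-Library.FuncSet"
begin

definition cofinite_in :: "'a set \<Rightarrow> 'a set \<Rightarrow> bool" where
  "cofinite_in \<Omega> A \<longleftrightarrow> A \<subseteq> \<Omega> \<and> finite (\<Omega> - A)"

definition almost_equal :: "'a set \<Rightarrow> ('a \<Rightarrow> 'a) \<Rightarrow> ('a \<Rightarrow> 'a) \<Rightarrow> bool" where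
  "almost_equal \<Omega> f g \<longleftrightarrow> finite {\<omega> \<in> \<Omega>. f \<omega> \<noteq> g \<omega>}"

end

theory Submission
  imports Defs
begin

text \<open>
  The proof is a pigeonhole count on the finite set \<open>D\<close> of points where \<open>f\<close> and \<open>g\<close> differ.
  Off \<open>D\<close> the two maps agree, so \<open>g\<close> being onto, its values on \<open>D\<close> must account for everything
  that \<open>f\<close> misses on \<open>\<Omega> - D\<close>: the \<open>card D\<close> values of \<open>f\<close> on \<open>D\<close> (by injectivity) and also any
  point outside the range of \<open>f\<close>. These are more than \<open>card D\<close> points.
\<close>

theorem theorem4:
  fixes \<Omega> :: "'a set" and f g :: "'a \<Rightarrow> 'a"
  assumes "infinite \<Omega>"
    and "f \<in> \<Omega> \<rightarrow> \<Omega>" and "inj_on f \<Omega>"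
    and "cofinite_in \<Omega> (f ` \<Omega>)" and "f ` \<Omega> \<subset> \<Omega>"
    and "g \<in> \<Omega> \<rightarrow> \<Omega>" and "g ` \<Omega> = \<Omega>"
  shows "\<not> almost_equal \<Omega> g f"
proof
  assume ae: "almost_equal \<Omega> g f"
  define D where "D = {\<omega> \<in> \<Omega>. g \<omega> \<noteq> f \<omega>}"
  have fin: "finite D"
    using ae by (simp add: almost_equal_def D_def)
  have DO: "D \<subseteq> \<Omega>"
    by (auto simp: D_def)
  obtain p where p: "p \<in> \<Omega>" "p \<notin> f ` \<Omega>"
    using \<open>f ` \<Omega> \<subset> \<Omega>\<close> by blast
  have "insert p (f ` D) \<subseteq> g ` D"
  proof
    fix y assume y: "y \<in> insert p (f ` D)"
    then have "y \<in> \<Omega>"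
      using p DO \<open>f \<in> \<Omega> \<rightarrow> \<Omega>\<close> by auto
    then obtain x where x: "x \<in> \<Omega>" "y = g x"
      using \<open>g ` \<Omega> = \<Omega>\<close> by blast
    have "x \<in> D"
    proof (rule ccontr)
      assume "x \<notin> D"
      then have "y = f x"
        using x by (simp add: D_def)
      then have "y \<in> f ` D"
        using y p x by auto
      then show False
        using \<open>x \<notin> D\<close> \<open>y = f x\<close> x DO inj_on_image_mem_iff[OF \<open>inj_on f \<Omega>\<close>] by blast
    qed
    then show "y \<in> g ` D"
      using x by blast
  qed
  then have "card (insert p (f ` D)) \<le> card (g ` D)"
    using fin by (intro card_mono) auto
  also have "\<dots> \<le> card D"
    by (rule card_image_le[OF fin])
  finally have "card (insert p (f ` D)) \<le> card D" .
  moreover have "card (insert p (f ` D)) = Suc (card D)"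
  proof -
    have "p \<notin> f ` D"
      using p DO by blast
    then show ?thesis
      using fin card_image[OF inj_on_subset[OF \<open>inj_on f \<Omega>\<close> DO]] by simp
  qed
  ultimately show False
    by simp
qed

end
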